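(* Let $\mathbb{S}^6\subset\mathbb{R}^7$ be the unit sphere with its nearly Kähler structure $(J,g)$ inherited from the pure octonions product: $g$ is the metric induced by the Euclidean metric of $\mathbb{R}^7$ and $J_pw=p\times w$ for $p\in\mathbb{S}^6$, $w\in T_p\mathbb{S}^6$. Let $\omega(\cdot,\cdot)=g(J\cdot,\cdot)$. Then there are no smooth functions $a,b,c\colon\mathbb{S}^6\to\mathbb{R}$ with $a^2+b^2+c^2=1$ such that the bundle endomorphism $$\mathcal{J}=a\,\mathcal{J}_{1,J}+b\,\mathcal{J}_g+c\,\mathcal{J}_\omega$$ of $T\mathbb{S}^6\oplus T^*\mathbb{S}^6$ is a weak generalized complex structure (that is, satisfies $\mathcal{J}^2=-\mathrm{Id}$ and is integrable with respect to the Dorfman bracket).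
   Context: All manifolds, functions and tensor fields are smooth. For a manifold $M$, $\mathbb{T}M:=TM\oplus T^*M$ is the generalized tangent bundle; its sections are sums $X+\xi$ of a vector field $X$ and a 1-form $\xi$. A weak generalized almost complex structure is a bundle endomorphism $\mathcal{J}\colon\mathbb{T}M\to\mathbb{T}M$ (over the identity of $M$) with $\mathcal{J}^2=-\mathrm{Id}$. The Dorfman bracket is $[\![X+\xi,Y+\eta]\!]=[X,Y]+\mathcal{L}_X\eta-i_Yd\xi$, extended $\mathbb{C}$-bilinearly to sections of $\mathbb{T}M\otimes\mathbb{C}$. A weak generalized almost complex structure $\mathcal{J}$ is integrable, and is then called a weak generalized complex structure, if the subbundle $\mathbb{L}^{1,0}_{\mathcal{J}}=\{u-i\mathcal{J}u: u\in\mathbb{T}M\}\subset\mathbb{T}M\otimes\mathbb{C}$ is involutive, i.e. $[\![u-i\mathcal{J}u,v-i\mathcal{J}v]\!]\in\Gamma(\mathbb{L}^{1,0}_{\mathcal{J}})$ for all $u,v\in\Gamma(\mathbb{T}M)$. Induced structures: - $\mathcal{J}_{1,J}(X+\xi)=JX+J^*\xi$, where $(J^*\xi)(X)=\xi(JX)$. - $\mathcal{J}_g(X+\xi)=-\sharp_g\xi+\flat_gX$, where $(\flat_gX)(Y)=g(X,Y)$ and $\sharp_g=\flat_g^{-1}$. - $\mathcal{J}_\omega(X+\xi)=-\sharp_\omega\xi+\flat_\omega X$, where $(\flat_\omega X)(Y)=\omega(X,Y)$ and $\sharp_\omega=\flat_\omega^{-1}$. Pure octonions product: identify $\mathbb{R}^7$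 isometrically with the imaginary octonions; $x\times y$ is the imaginary part of the octonion product $xy$. Concretely, one may take the bilinear skew-symmetric product on $\mathbb{R}^7$ with standard basis $e_1,\dots,e_7$ such that $e_i\times e_j=e_k$ for $(i,j,k)$ equal to, or a cyclic permutation of, one of $(1,2,3),(1,4,5),(1,7,6),(2,4,6),(2,5,7),(3,4,7),(3,6,5)$. *)

theory Defs
  imports "HOL-Analysis.Analysis"
begin

section \<open>Smooth maps\<close>

primrec Ck_on :: "nat \<Rightarrow> 'a::real_normed_vector set \<Rightarrow> ('a \<Rightarrow> 'b::real_normed_vector) \<Rightarrow> bool" where
  "Ck_on 0 U f \<longleftrightarrow> continuous_on U f"
| "Ck_on (Suc k) U f \<longleftrightarrow> (\<forall>x\<in>U. f differentiable (at x)) \<and>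
     (\<forall>v. Ck_on k U (\<lambda>x. frechet_derivative f (at x) v))"

text \<open>Intended for open sets \<open>U\<close> only.\<close>
definition smooth_on :: "'a::real_normed_vector set \<Rightarrow> ('a \<Rightarrow> 'b::real_normed_vector) \<Rightarrow> bool" where
  "smooth_on U f \<longleftrightarrow> (\<forall>k. Ck_on k U f)"


section \<open>The six-sphere as a submanifold of \<open>\<real>\<^sup>7\<close>\<close>

text \<open>
  Functions, sections and bundle maps on the sphere are total functions on \<open>real^7\<close>; every notion
  below depends only on their values at points of the sphere (and on the fibres over those points).
\<close>

abbreviation S6 :: "(real^7) set" where
  "S6 \<equiv> sphere 0 1"

definition smooth_S6 :: "(real^7 \<Rightarrow> 'b::real_normed_vector) \<Rightarrow> bool" where
  "smooth_S6 f \<longleftrightarrow>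
     (\<forall>p\<in>S6. \<exists>U F. open U \<and> p \<in> U \<and> smooth_on U F \<and> (\<forall>x\<in>U \<inter> S6. F x = f x))"

definition tangent :: "real^7 \<Rightarrow> (real^7) set" where
  "tangent p = {w. p \<bullet> w = 0}"

definition tproj :: "real^7 \<Rightarrow> real^7 \<Rightarrow> real^7" where
  "tproj p w = w - (p \<bullet> w) *\<^sub>R p"

text \<open>
  The differential at \<open>p\<close>, for \<open>p\<close> on the sphere and tangent \<open>v\<close>, of a map \<open>f\<close> defined on the
  sphere. It is the ordinary derivative of the extension \<open>x \<mapsto> f (x / |x|)\<close> of \<open>f\<close> to \<open>\<real>\<^sup>7\<close> minus
  the origin; on tangent vectors any other smooth extension gives the same value.
\<close>
definition diff_S6 :: "(real^7 \<Rightarrow> 'b::real_normed_vector) \<Rightarrow> real^7 \<Rightarrow> real^7 \<Rightarrow> 'b" where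
  "diff_S6 f p v = frechet_derivative (\<lambda>x. f (sgn x)) (at p) v"


section \<open>Covectors and the generalized tangent bundle\<close>

type_synonym covector = "(real^7) \<Rightarrow>\<^sub>L real"
type_synonym gtv = "(real^7) \<times> covector"

text \<open>
  A linear functional on the tangent space at \<open>p\<close> is represented by its unique linear extension to
  \<open>\<real>\<^sup>7\<close> that vanishes on the normal vector \<open>p\<close>; \<open>covec p \<phi>\<close> is the representative of the functional
  given by \<open>\<phi>\<close> on the tangent space. Thus two elements of \<open>cotangent p\<close> are equal iff they
  agree on the tangent space.
\<close>
definition cotangent :: "real^7 \<Rightarrow> covector set" where
  "cotangent p = {\<xi>. blinfun_apply \<xi> p = 0}"

definition covec :: "real^7 \<Rightarrow> (real^7 \<Rightarrow> real) \<Rightarrow> covector" where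
  "covec p \<phi> = Blinfun (\<lambda>w. \<phi> (tproj p w))"

definition gen_tangent :: "real^7 \<Rightarrow> gtv set" where
  "gen_tangent p = tangent p \<times> cotangent p"

definition sections :: "(real^7 \<Rightarrow> 'b::real_normed_vector set) \<Rightarrow> (real^7 \<Rightarrow> 'b) set" where
  "sections E = {s. smooth_S6 s \<and> (\<forall>p\<in>S6. s p \<in> E p)}"


section \<open>Cartan calculus and the Dorfman bracket\<close>

definition lie_bracket :: "(real^7 \<Rightarrow> real^7) \<Rightarrow> (real^7 \<Rightarrow> real^7) \<Rightarrow> real^7 \<Rightarrow> real^7" where
  "lie_bracket X Y p = diff_S6 Y p (X p) - diff_S6 X p (Y p)"

text \<open>
  The Lie derivative and the exterior derivative are given at \<open>p\<close> by the invariant formulas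
  \<open>(L\<^sub>X \<eta>)(W) = X(\<eta>(W)) - \<eta>([X,W])\<close> and \<open>d\<xi>(V,W) = V(\<xi>(W)) - W(\<xi>(V)) - \<xi>([V,W])\<close>.
  Both are tensorial in \<open>V\<close>, \<open>W\<close>, so tangent vectors \<open>v\<close>, \<open>w\<close> at \<open>p\<close> may be extended by
  \<open>extend v\<close>, \<open>extend w\<close>, vector fields on the whole sphere with these values at \<open>p\<close>.
\<close>
definition extend :: "real^7 \<Rightarrow> real^7 \<Rightarrow> real^7" where
  "extend w = (\<lambda>x. tproj x w)"

definition lie_derivative :: "(real^7 \<Rightarrow> real^7) \<Rightarrow> (real^7 \<Rightarrow> covector) \<Rightarrow> real^7 \<Rightarrow> covector" where
  "lie_derivative X \<eta> p = covec p (\<lambda>w.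
     diff_S6 (\<lambda>x. blinfun_apply (\<eta> x) (extend w x)) p (X p)
     - blinfun_apply (\<eta> p) (lie_bracket X (extend w) p))"

definition ext_derivative :: "(real^7 \<Rightarrow> covector) \<Rightarrow> real^7 \<Rightarrow> real^7 \<Rightarrow> real^7 \<Rightarrow> real" where
  "ext_derivative \<xi> p v w =
     diff_S6 (\<lambda>x. blinfun_apply (\<xi> x) (extend w x)) p v
     - diff_S6 (\<lambda>x. blinfun_apply (\<xi> x) (extend v x)) p w
     - blinfun_apply (\<xi> p) (lie_bracket (extend v) (extend w) p)"

definition dorfman :: "(real^7 \<Rightarrow> gtv) \<Rightarrow> (real^7 \<Rightarrow> gtv) \<Rightarrow> real^7 \<Rightarrow> gtv" where
  "dorfman u v p =
     (let X = fst \<circ> u; \<xi> = snd \<circ> u; Y = fst \<circ> v; \<eta> = snd \<circ> v in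
       (lie_bracket X Y p,
        lie_derivative X \<eta> p - covec p (\<lambda>w. ext_derivative \<xi> p (Y p) w)))"

text \<open>A pair \<open>(A, B)\<close> stands for \<open>A + iB\<close> in the complexification.\<close>
type_synonym cgtv = "gtv \<times> gtv"

definition dorfman_C :: "(real^7 \<Rightarrow> cgtv) \<Rightarrow> (real^7 \<Rightarrow> cgtv) \<Rightarrow> real^7 \<Rightarrow> cgtv" where
  "dorfman_C s t p =
     (let A = fst \<circ> s; B = snd \<circ> s; C = fst \<circ> t; D = snd \<circ> t in
       (dorfman A C p - dorfman B D p, dorfman A D p + dorfman B C p))"


section \<open>Weak generalized complex structures\<close>

definition bundle_endomorphism :: "(real^7 \<Rightarrow> gtv \<Rightarrow> gtv) \<Rightarrow> bool" where
  "bundle_endomorphism \<J> \<longleftrightarrow>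
     (\<forall>p\<in>S6. \<forall>u\<in>gen_tangent p. \<J> p u \<in> gen_tangent p) \<and>
     (\<forall>p\<in>S6. \<forall>u\<in>gen_tangent p. \<forall>v\<in>gen_tangent p. \<J> p (u + v) = \<J> p u + \<J> p v) \<and>
     (\<forall>p\<in>S6. \<forall>r. \<forall>u\<in>gen_tangent p. \<J> p (r *\<^sub>R u) = r *\<^sub>R \<J> p u) \<and>
     (\<forall>u\<in>sections gen_tangent. smooth_S6 (\<lambda>p. \<J> p (u p)))"

definition weak_gen_almost_complex :: "(real^7 \<Rightarrow> gtv \<Rightarrow> gtv) \<Rightarrow> bool" where
  "weak_gen_almost_complex \<J> \<longleftrightarrow>
     bundle_endomorphism \<J> \<and> (\<forall>p\<in>S6. \<forall>u\<in>gen_tangent p. \<J> p (\<J> p u) = - u)"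

text \<open>\<open>u - i \<J> u\<close>\<close>
definition holo_part :: "(gtv \<Rightarrow> gtv) \<Rightarrow> gtv \<Rightarrow> cgtv" where
  "holo_part J u = (u, - J u)"

definition L10 :: "(real^7 \<Rightarrow> gtv \<Rightarrow> gtv) \<Rightarrow> real^7 \<Rightarrow> cgtv set" where
  "L10 \<J> p = holo_part (\<J> p) ` gen_tangent p"

definition integrable_gen :: "(real^7 \<Rightarrow> gtv \<Rightarrow> gtv) \<Rightarrow> bool" where
  "integrable_gen \<J> \<longleftrightarrow>
     (\<forall>u\<in>sections gen_tangent. \<forall>v\<in>sections gen_tangent.
        dorfman_C (\<lambda>p. holo_part (\<J> p) (u p)) (\<lambda>p. holo_part (\<J> p) (v p)) \<in> sections (L10 \<J>))"

definition weak_gen_complex :: "(real^7 \<Rightarrow> gtv \<Rightarrow> gtv) \<Rightarrow> bool" where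
  "weak_gen_complex \<J> \<longleftrightarrow> weak_gen_almost_complex \<J> \<and> integrable_gen \<J>"


section \<open>The nearly Kaehler structure of the six-sphere and the induced structures\<close>

text \<open>Oriented lines of the Fano plane; the index \<open>7\<close> is the element \<open>0\<close> of the index type.\<close>
definition fano :: "(7 \<times> 7 \<times> 7) list" where
  "fano = [(1,2,3), (1,4,5), (1,7,6), (2,4,6), (2,5,7), (3,4,7), (3,6,5)]"

definition cross7 :: "real^7 \<Rightarrow> real^7 \<Rightarrow> real^7" where
  "cross7 x y = (\<Sum>(i,j,k)\<leftarrow>fano.
       (x $ i * y $ j - x $ j * y $ i) *\<^sub>R axis k 1
     + (x $ j * y $ k - x $ k * y $ j) *\<^sub>R axis i 1
     + (x $ k * y $ i - x $ i * y $ k) *\<^sub>R axis j 1)"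

definition acs :: "real^7 \<Rightarrow> real^7 \<Rightarrow> real^7" where
  "acs p w = cross7 p w"

definition round_metric :: "real^7 \<Rightarrow> real^7 \<Rightarrow> real^7 \<Rightarrow> real" where
  "round_metric p X Y = X \<bullet> Y"

definition fund_form :: "real^7 \<Rightarrow> real^7 \<Rightarrow> real^7 \<Rightarrow> real" where
  "fund_form p X Y = round_metric p (acs p X) Y"

definition flat :: "(real^7 \<Rightarrow> real^7 \<Rightarrow> real^7 \<Rightarrow> real) \<Rightarrow> real^7 \<Rightarrow> real^7 \<Rightarrow> covector" where
  "flat \<beta> p X = covec p (\<lambda>Y. \<beta> p X Y)"

definition sharp :: "(real^7 \<Rightarrow> real^7 \<Rightarrow> real^7 \<Rightarrow> real) \<Rightarrow> real^7 \<Rightarrow> covector \<Rightarrow> real^7" where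
  "sharp \<beta> p = inv_into (tangent p) (flat \<beta> p)"

definition J_one :: "real^7 \<Rightarrow> gtv \<Rightarrow> gtv" where
  "J_one p = (\<lambda>(X, \<xi>). (acs p X, covec p (\<lambda>Y. blinfun_apply \<xi> (acs p Y))))"

definition J_bilin :: "(real^7 \<Rightarrow> real^7 \<Rightarrow> real^7 \<Rightarrow> real) \<Rightarrow> real^7 \<Rightarrow> gtv \<Rightarrow> gtv" where
  "J_bilin \<beta> p = (\<lambda>(X, \<xi>). (- sharp \<beta> p \<xi>, flat \<beta> p X))"

end

(*
  If f vanishes at p, then [[f u, v]] = -(rho(v) f) u + <u, v> df at p. Choosing df killed by the
  vector part of v, involutivity of L^{1,0} puts <u, v> df into L^{1,0} for all sections u, v of
  L^{1,0}; as df is real and L^{1,0} meets its conjugate only in 0, L^{1,0} is isotropic, that is,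
  J is skew for the pairing. Now J_{1,J} and J_g are symmetric and J_omega is skew, so a = b = 0
  and c is a constant sign. Then involutivity forces d omega = 0, whereas d omega is three times
  the restriction of the form (x, y, z) |-> (x cross y) . z, which does not vanish on e_2, e_4, e_6
  at the point e_1.
*)
theory Submission
  imports Defs
begin

section \<open>Smooth maps on the whole space\<close>

text \<open>Derivatives are unique, so an explicit \<open>f'\<close> may replace
  \<open>frechet_derivative\<close>. The steps to order k + 1 below go through this rule; the whole
  space suffices as domain because the test sections are restrictions of fields on R^7.\<close>

lemma Ck_on_UNIV_SucI:
  assumes "\<And>x. (f has_derivative f' x) (at x)" "\<And>v. Ck_on k UNIV (\<lambda>x. f' x v)"
  shows "Ck_on (Suc k) UNIV f"
proof -
  have "frechet_derivative f (at x) = f' x" for x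
    using frechet_derivative_at[OF assms(1)] by simp
  then show ?thesis
    using assms by (auto simp: differentiable_def)
qed

text \<open>Serves the product rule, where the undifferentiated factor of each term has to be
  lowered from order k + 1 to order k.\<close>

lemma Ck_on_SucD:
  assumes "Ck_on (Suc k) U f"
  shows "Ck_on k U f"
  using assms
proof (induction k arbitrary: f)
  case 0
  then show ?case
    by (auto intro!: continuous_at_imp_continuous_on differentiable_imp_continuous_within)
next
  case (Suc k)
  from Suc.prems have "Ck_on (Suc k) U (\<lambda>x. frechet_derivative f (at x) v)" for v
    by simp
  from Suc.IH[OF this] show ?case
    using Suc.prems by simp
qed

lemma Ck_on_UNIV_SucD:
  assumes "Ck_on (Suc k) UNIV f"
  shows "(f has_derivative frechet_derivative f (at x)) (at x)"
    and "Ck_on k UNIV (\<lambda>x. frechet_derivative f (at x) v)"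
  using assms frechet_derivative_works by auto

lemma smooth_on_UNIV_const: "smooth_on UNIV (\<lambda>x. c)"
proof -
  have "Ck_on k UNIV (\<lambda>x :: 'a. c :: 'b)" for k c
    by (induction k arbitrary: c)
      (auto intro!: Ck_on_UNIV_SucI[where f' = "\<lambda>_ _. 0"] simp del: Ck_on.simps(2))
  then show ?thesis
    by (simp add: smooth_on_def)
qed

lemma smooth_on_UNIV_id: "smooth_on UNIV (\<lambda>x. x)"
  unfolding smooth_on_def
proof
  fix k
  show "Ck_on k UNIV (\<lambda>x :: 'a. x)"
  proof (cases k)
    case (Suc j)
    show ?thesis
      unfolding Suc using smooth_on_UNIV_const
      by (intro Ck_on_UNIV_SucI[where f' = "\<lambda>_ v. v"]) (auto simp: smooth_on_def)
  qed simp
qed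

lemma Ck_on_UNIV_add:
  assumes "Ck_on k UNIV f" "Ck_on k UNIV g"
  shows "Ck_on k UNIV (\<lambda>x. f x + g x)"
  using assms
proof (induction k arbitrary: f g)
  case 0
  then show ?case by (auto intro!: continuous_intros)
next
  case (Suc k)
  note D = Ck_on_UNIV_SucD[OF Suc.prems(1)] Ck_on_UNIV_SucD[OF Suc.prems(2)]
  show ?case
    by (rule Ck_on_UNIV_SucI) (rule has_derivative_add[OF D(1,3)], rule Suc.IH[OF D(2,4)])
qed

lemma smooth_on_UNIV_add:
  assumes "smooth_on UNIV f" "smooth_on UNIV g"
  shows "smooth_on UNIV (\<lambda>x. f x + g x)"
  using assms by (simp add: smooth_on_def Ck_on_UNIV_add)

lemma smooth_on_UNIV_bounded_linear:
  fixes f :: "'a::real_normed_vector \<Rightarrow> 'b::real_normed_vector"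
  assumes "bounded_linear L" "smooth_on UNIV f"
  shows "smooth_on UNIV (\<lambda>x. L (f x))"
proof -
  have "Ck_on k UNIV (\<lambda>x. L (f x))" if "Ck_on k UNIV f" for k and f :: "'a \<Rightarrow> 'b"
    using that
  proof (induction k arbitrary: f)
    case 0
    then show ?case by (auto intro: bounded_linear.continuous_on[OF assms(1)])
  next
    case (Suc k)
    note D = Ck_on_UNIV_SucD[OF Suc.prems]
    show ?case
      by (rule Ck_on_UNIV_SucI)
        (rule bounded_linear.has_derivative[OF assms(1) D(1)], rule Suc.IH[OF D(2)])
  qed
  then show ?thesis
    using assms by (simp add: smooth_on_def)
qed

lemma smooth_on_UNIV_bilinear:
  fixes f :: "'a::real_normed_vector \<Rightarrow> 'b::real_normed_vector"
    and g :: "'a \<Rightarrow> 'c::real_normed_vector"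
  assumes "bounded_bilinear B" "smooth_on UNIV f" "smooth_on UNIV g"
  shows "smooth_on UNIV (\<lambda>x. B (f x) (g x))"
proof -
  have "Ck_on k UNIV (\<lambda>x. B (f x) (g x))" if "Ck_on k UNIV f" "Ck_on k UNIV g"
    for k and f :: "'a \<Rightarrow> 'b" and g :: "'a \<Rightarrow> 'c"
    using that
  proof (induction k arbitrary: f g)
    case 0
    then show ?case by (auto intro: bounded_bilinear.continuous_on[OF assms(1)])
  next
    case (Suc k)
    note D = Ck_on_UNIV_SucD[OF Suc.prems(1)] Ck_on_UNIV_SucD[OF Suc.prems(2)]
    show ?case
      by (rule Ck_on_UNIV_SucI, rule bounded_bilinear.FDERIV[OF assms(1) D(1,3)],
          rule Ck_on_UNIV_add[OF Suc.IH[OF Ck_on_SucD[OF Suc.prems(1)] D(4)]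
            Suc.IH[OF D(2) Ck_on_SucD[OF Suc.prems(2)]]])
  qed
  then show ?thesis
    using assms by (simp add: smooth_on_def)
qed

lemma smooth_on_UNIV_diff:
  assumes "smooth_on UNIV f" "smooth_on UNIV g"
  shows "smooth_on UNIV (\<lambda>x. f x - g x)"
  using smooth_on_UNIV_add[OF assms(1)
      smooth_on_UNIV_bounded_linear[OF bounded_linear_minus[OF bounded_linear_ident] assms(2)]]
  by simp

text \<open>A pair is the sum of the images of its entries under the two bounded linear
  inclusions.\<close>

lemma smooth_on_UNIV_Pair:
  assumes "smooth_on UNIV f" "smooth_on UNIV g"
  shows "smooth_on UNIV (\<lambda>x. (f x, g x))"
proof -
  have "bounded_linear (\<lambda>y :: 'b. (y, 0 :: 'c))" "bounded_linear (\<lambda>z :: 'c. (0 :: 'b, z))"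
    by (intro bounded_linear_Pair bounded_linear_ident bounded_linear_zero)+
  from smooth_on_UNIV_add[OF smooth_on_UNIV_bounded_linear[OF this(1) assms(1)]
      smooth_on_UNIV_bounded_linear[OF this(2) assms(2)]]
  show ?thesis by simp
qed

lemma smooth_on_UNIV_linear:
  "bounded_linear L \<Longrightarrow> smooth_on UNIV L"
  using smooth_on_UNIV_bounded_linear[OF _ smooth_on_UNIV_id] .

lemma smooth_S6_of_UNIV: "smooth_on UNIV f \<Longrightarrow> smooth_S6 f"
  unfolding smooth_S6_def by (metis IntD2 UNIV_I open_UNIV)

section \<open>Differentials on the sphere\<close>

lemma tproj_idem: "p \<in> S6 \<Longrightarrow> tproj p (tproj p w) = tproj p w"
  by (simp add: tproj_def inner_diff_right dot_square_norm)

lemma tproj_tangent: "w \<in> tangent p \<Longrightarrow> tproj p w = w"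
  by (simp add: tproj_def tangent_def)

lemma tproj_in_tangent: "p \<in> S6 \<Longrightarrow> tproj p w \<in> tangent p"
  by (simp add: tproj_def tangent_def inner_diff_right dot_square_norm)

lemma bounded_linear_tproj: "bounded_linear (tproj p)"
  unfolding tproj_def by (intro bounded_linear_intros)

text \<open>The radial retraction is x / |x|; the product rule at |p| = 1 gives h - (h . p) p, the
  orthogonal projection onto the tangent space.\<close>

lemma has_derivative_sgn_S6:
  assumes "p \<in> S6"
  shows "(sgn has_derivative tproj p) (at p)"
proof -
  have [simp]: "norm p = 1" "p \<noteq> 0" using assms by auto
  have "(norm has_derivative (\<lambda>h. h \<bullet> sgn p)) (at p)"
    by (rule has_derivative_norm) simp
  from has_derivative_scaleR[OF Deriv.has_derivative_inverse[OF _ this] has_derivative_ident]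
  have "((\<lambda>x. inverse (norm x) *\<^sub>R x) has_derivative
      (\<lambda>h. inverse (norm p) *\<^sub>R h + (- (inverse (norm p) * (h \<bullet> sgn p) * inverse (norm p))) *\<^sub>R p))
      (at p)"
    by simp
  moreover have "sgn p = p" by (simp add: sgn_div_norm)
  moreover have "sgn = (\<lambda>x :: real^7. inverse (norm x) *\<^sub>R x)" by (simp add: fun_eq_iff sgn_div_norm)
  ultimately show ?thesis
    by (simp add: tproj_def[abs_def] inner_commute)
qed

text \<open>\<open>diff_S6\<close> is defined by the radial extension. The chain rule through
  \<open>sgn\<close> shows that any local extension \<open>F\<close> differentiable at
  \<open>p\<close> gives the same values on tangent vectors.\<close>

lemma has_derivative_S6:
  assumes "p \<in> S6" "open U" "p \<in> U" "\<And>x. x \<in> U \<Longrightarrow> x \<in> S6 \<Longrightarrow> F x = f x"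
    and "(F has_derivative F') (at p)"
  shows "((\<lambda>x. f (sgn x)) has_derivative (\<lambda>h. F' (tproj p h))) (at p)"
proof -
  have p: "sgn p = p" "p \<noteq> 0" using assms(1) by (auto simp: sgn_div_norm)
  \<comment> \<open>The open cone of points whose radial projection lies in
    \<open>U\<close>.\<close>
  define V where "V = (sgn -` U) \<inter> - {0 :: real^7}"
  have "continuous_on (- {0 :: real^7}) sgn"
    by (intro continuous_intros) auto
  then have V: "open V"
    unfolding V_def using continuous_open_preimage[OF _ _ assms(2), of "- {0}" sgn]
    by (simp add: open_Compl Int_commute)
  have eq: "F (sgn x) = f (sgn x)" if "x \<in> V" for x
    using that by (intro assms(4)) (simp_all add: V_def norm_sgn)
  have "((\<lambda>x. F (sgn x)) has_derivative (\<lambda>h. F' (tproj p h))) (at p)"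
    using has_derivative_compose[OF has_derivative_sgn_S6[OF assms(1)]] assms(5) p by simp
  then show ?thesis
    by (rule has_derivative_transform_within_open[OF _ V _ eq]) (simp add: V_def p assms(3))
qed

lemma smooth_S6_differentiable:
  assumes "smooth_S6 f" "p \<in> S6"
  shows "(\<lambda>x. f (sgn x)) differentiable (at p)"
proof -
  obtain U F where U: "open U" "p \<in> U" "smooth_on U F" "\<forall>x\<in>U \<inter> S6. F x = f x"
    using assms unfolding smooth_S6_def by meson
  then have "Ck_on (Suc 0) U F" by (auto simp: smooth_on_def simp del: Ck_on.simps)
  then have "F differentiable at p" using U(2) by simp
  then show ?thesis
    using has_derivative_S6[OF assms(2) U(1,2), of F f] U(4) unfolding differentiable_def by blast
qed

text \<open>On the sphere \<open>f\<close> equals its radial extension, which is differentiable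
  there. Serves to make \<open>c\<close> constant at the end.\<close>

lemma smooth_S6_continuous_on:
  assumes "smooth_S6 f"
  shows "continuous_on S6 f"
proof -
  have "continuous_on S6 (\<lambda>x. f (sgn x))"
    using smooth_S6_differentiable[OF assms]
    by (intro continuous_at_imp_continuous_on ballI differentiable_imp_continuous_within)
  then show ?thesis
    by (rule continuous_on_cong[THEN iffD1, rotated -1]) (auto simp: sgn_div_norm)
qed

lemma diff_S6_eqI:
  assumes "((\<lambda>x. f (sgn x)) has_derivative D) (at p)"
  shows "diff_S6 f p = D"
  using frechet_derivative_at[OF assms] by (simp add: diff_S6_def fun_eq_iff)

lemma diff_S6_bounded_linear:
  assumes "p \<in> S6" "bounded_linear F" "\<And>x. x \<in> S6 \<Longrightarrow> f x = F x"
  shows "diff_S6 f p v = F (tproj p v)"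
proof -
  have "((\<lambda>x. f (sgn x)) has_derivative (\<lambda>h. F (tproj p h))) (at p)"
    using assms by (intro has_derivative_S6[OF assms(1) open_UNIV, of F f])
      (auto intro: bounded_linear_imp_has_derivative)
  then show ?thesis by (simp add: diff_S6_eqI)
qed

text \<open>Where a map is not differentiable, \<open>frechet_derivative\<close> is an arbitrary
  choice, hence the assumption.\<close>

lemma diff_S6_zero:
  assumes "(\<lambda>x. f (sgn x)) differentiable (at p)"
  shows "diff_S6 f p 0 = 0"
  using linear_0[OF linear_frechet_derivative[OF assms]] by (simp add: diff_S6_def)

text \<open>The radial extensions agree off the origin and so have the same derivatives at
  \<open>p\<close>, if any; the choice made in \<open>frechet_derivative\<close> is then the same
  too.\<close>

lemma diff_S6_cong:
  assumes "p \<in> S6" "\<And>x. x \<in> S6 \<Longrightarrow> f x = g x"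
  shows "diff_S6 f p = diff_S6 g p"
proof -
  have *: "((\<lambda>x. g (sgn x)) has_derivative D) (at p)"
    if "((\<lambda>x. f (sgn x)) has_derivative D) (at p)" "\<And>x. x \<in> S6 \<Longrightarrow> f x = g x" for D and f g :: "real^7 \<Rightarrow> 'a"
    using assms(1) that(2)
    by (intro has_derivative_transform_within_open[OF that(1), of "- {0}"]) (auto simp: norm_sgn)
  have "((\<lambda>x. f (sgn x)) has_derivative D) (at p) \<longleftrightarrow> ((\<lambda>x. g (sgn x)) has_derivative D) (at p)"
    for D
    by (intro iffI; erule *) (simp_all add: assms(2))
  then show ?thesis
    unfolding diff_S6_def[abs_def] frechet_derivative_def by simp
qed

section \<open>Covectors\<close>

lemma covec_apply:
  assumes "bounded_linear \<phi>"
  shows "blinfun_apply (covec p \<phi>) w = \<phi> (tproj p w)"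
  unfolding covec_def
  using bounded_linear_compose[OF assms bounded_linear_tproj] by (simp add: bounded_linear_Blinfun_apply)

lemma covec_0: "covec p (\<lambda>_. 0) = 0"
  by (simp add: covec_def zero_blinfun_def)

text \<open>Precomposition with the projection subtracts the normal component. The formula displays
  the polynomial dependence on \<open>p\<close>, from which smoothness in \<open>p\<close> is read
  off.\<close>

lemma covec_blinfun: "covec p (blinfun_apply \<xi>) = \<xi> - blinfun_apply \<xi> p *\<^sub>R blinfun_inner_right p"
  by (rule blinfun_eqI)
    (simp add: covec_apply blinfun.bounded_linear_right tproj_def blinfun.diff_right
      blinfun.scaleR_right blinfun.diff_left blinfun.scaleR_left)

lemma covec_in_cotangent:
  assumes "p \<in> S6" "bounded_linear \<phi>"
  shows "covec p \<phi> \<in> cotangent p"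
proof -
  have "tproj p p = 0" using assms(1) by (simp add: tproj_def dot_square_norm)
  then show ?thesis
    using assms(2) by (simp add: cotangent_def covec_apply linear_0 bounded_linear.linear)
qed

lemma smooth_on_tproj_covec:
  "smooth_on UNIV (\<lambda>x. (tproj x v, covec x (blinfun_apply \<xi>)))"
  unfolding tproj_def covec_blinfun
  by (rule smooth_on_UNIV_Pair smooth_on_UNIV_diff smooth_on_UNIV_const
      smooth_on_UNIV_bilinear[OF bounded_bilinear_scaleR] smooth_on_UNIV_id
      smooth_on_UNIV_linear[OF bounded_linear_inner_left]
      smooth_on_UNIV_linear[OF blinfun.bounded_linear_right]
      smooth_on_UNIV_linear[OF bounded_linear_blinfun_inner_right])+

lemma tproj_covec_in_gen_tangent:
  "x \<in> S6 \<Longrightarrow> (tproj x v, covec x (blinfun_apply \<xi>)) \<in> gen_tangent x"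
  by (simp add: gen_tangent_def tproj_in_tangent covec_in_cotangent blinfun.bounded_linear_right)

lemma gen_tangent_scaleR: "u \<in> gen_tangent p \<Longrightarrow> r *\<^sub>R u \<in> gen_tangent p"
  by (auto simp: gen_tangent_def tangent_def cotangent_def blinfun.scaleR_left)

text \<open>A fixed vector and a fixed covector, projected at each point, form a global section. The
  multiple by a linear function is included because the isotropy argument brackets f s with f
  vanishing at \<open>p\<close>.\<close>

lemma smooth_section_through:
  assumes "u \<in> gen_tangent p" "bounded_linear f"
  obtains s where "s \<in> sections gen_tangent" "(\<lambda>x. f x *\<^sub>R s x) \<in> sections gen_tangent" "s p = u"
proof
  let ?s = "\<lambda>x. (tproj x (fst u), covec x (blinfun_apply (snd u)))"
  show "?s \<in> sections gen_tangent"
    by (simp add: sections_def smooth_S6_of_UNIV smooth_on_tproj_covec tproj_covec_in_gen_tangent)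
  have "smooth_on UNIV (\<lambda>x. f x *\<^sub>R ?s x)"
    by (intro smooth_on_UNIV_bilinear[OF bounded_bilinear_scaleR] smooth_on_tproj_covec
        smooth_on_UNIV_linear[OF assms(2)])
  then show "(\<lambda>x. f x *\<^sub>R ?s x) \<in> sections gen_tangent"
    unfolding sections_def
    by (intro CollectI conjI ballI smooth_S6_of_UNIV gen_tangent_scaleR tproj_covec_in_gen_tangent)
  show "?s p = u"
    using assms(1) by (cases u) (auto simp: gen_tangent_def tproj_tangent covec_blinfun cotangent_def)
qed

lemma covec_cong:
  assumes "p \<in> S6" "\<And>w. w \<in> tangent p \<Longrightarrow> \<phi> w = \<psi> w"
  shows "covec p \<phi> = covec p \<psi>"
  using assms by (simp add: covec_def tproj_in_tangent)

lemma covec_diff: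
  assumes "bounded_linear \<phi>" "bounded_linear \<psi>"
  shows "covec p \<phi> - covec p \<psi> = covec p (\<lambda>w. \<phi> w - \<psi> w)"
  by (rule blinfun_eqI) (simp add: covec_apply assms bounded_linear_sub blinfun.diff_left)

section \<open>Isotropy\<close>

definition pairing :: "gtv \<Rightarrow> gtv \<Rightarrow> real" where
  "pairing u v = blinfun_apply (snd u) (fst v) + blinfun_apply (snd v) (fst u)"

lemma pairing_minus: "pairing (- u) v = - pairing u v" "pairing u (- v) = - pairing u v"
  by (simp_all add: pairing_def blinfun.minus_left blinfun.minus_right)

text \<open>Leibniz rule at a zero of \<open>f\<close>: the term with the derivative of
  \<open>g\<close> drops out.\<close>

lemma diff_S6_scaleR_zero:
  assumes "p \<in> S6" "((\<lambda>x. f (sgn x)) has_derivative D) (at p)" "f p = 0"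
    and "(\<lambda>x. g (sgn x)) differentiable (at p)"
  shows "diff_S6 (\<lambda>x. f x *\<^sub>R g x) p w = D w *\<^sub>R g p"
proof -
  obtain G where "((\<lambda>x. g (sgn x)) has_derivative G) (at p)"
    using assms(4) by (auto simp: differentiable_def)
  from diff_S6_eqI[OF has_derivative_scaleR[OF assms(2) this]] show ?thesis
    using assms(1,3) by (simp add: sgn_div_norm)
qed

lemma extend_differentiable:
  assumes "p \<in> S6"
  shows "(\<lambda>x. extend w (sgn x)) differentiable (at p)"
proof -
  have "smooth_on UNIV (extend w)"
    using smooth_on_UNIV_bounded_linear[OF bounded_linear_fst smooth_on_tproj_covec[of w 0]]
    by (simp add: extend_def)
  then show ?thesis
    using smooth_S6_differentiable[OF smooth_S6_of_UNIV assms] by blast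
qed

text \<open>Write u = X + \<xi> and v = Y + \<eta>; \<open>covec p D\<close> is df. At a zero of f,
  the Lie derivative of \<eta> along fX is \<eta>(X) df, and contracting df wedge \<xi> with -Y
  gives \<xi>(Y) df - df(Y) \<xi>. The df terms add up to the pairing, while [fX, Y] leaves -df(Y)
  X.\<close>

lemma dorfman_scaleR_zero:
  assumes p: "p \<in> S6"
    and f: "((\<lambda>x. f (sgn x)) has_derivative D) (at p)" "f p = 0"
    and u: "(\<lambda>x. u (sgn x)) differentiable (at p)" "u p \<in> gen_tangent p"
    and v: "(\<lambda>x. v (sgn x)) differentiable (at p)" "v p \<in> gen_tangent p"
  shows "dorfman (\<lambda>x. f x *\<^sub>R u x) v p
    = (0, pairing (u p) (v p) *\<^sub>R covec p D) - D (fst (v p)) *\<^sub>R u p"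
proof -
  have lin: "bounded_linear D" using f(1) by (rule has_derivative_bounded_linear)
  obtain U V where UV: "((\<lambda>x. u (sgn x)) has_derivative U) (at p)"
    "((\<lambda>x. v (sgn x)) has_derivative V) (at p)"
    using u(1) v(1) unfolding differentiable_def by metis
  note d = differentiableI[OF has_derivative_fst[OF UV(1)]] differentiableI[OF has_derivative_snd[OF UV(1)]]
    differentiableI[OF has_derivative_fst[OF UV(2)]] differentiableI[OF has_derivative_snd[OF UV(2)]]
  have ap: "(\<lambda>x. blinfun_apply (\<zeta> (sgn x)) (extend w (sgn x))) differentiable (at p)"
    if \<zeta>: "(\<lambda>x. \<zeta> (sgn x)) differentiable (at p)" for \<zeta> w
    by (rule differentiableI[OF blinfun.FDERIV])
      (use \<zeta> extend_differentiable[OF p, of w] in \<open>simp_all only: frechet_derivative_works\<close>)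
  \<comment> \<open>\<open>Y\<close> is arbitrary because it stands both for the vector part of
    \<open>v\<close> and for the fields \<open>extend w\<close> inside the Lie derivative.\<close>
  have bracket: "lie_bracket (\<lambda>x. f x *\<^sub>R fst (u x)) Y p = - D (Y p) *\<^sub>R fst (u p)"
    if "(\<lambda>x. Y (sgn x)) differentiable (at p)" for Y
    using diff_S6_zero[OF that] diff_S6_scaleR_zero[OF p f d(1)] f(2)
    by (simp add: lie_bracket_def)
  have lie: "lie_derivative (\<lambda>x. f x *\<^sub>R fst (u x)) (\<lambda>x. snd (v x)) p
      = covec p (\<lambda>w. D w * blinfun_apply (snd (v p)) (fst (u p)))"
    unfolding lie_derivative_def
    using f(2) diff_S6_zero[OF ap[OF d(4)]] bracket[OF extend_differentiable[OF p]]
    by (intro covec_cong[OF p])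
      (simp add: blinfun.minus_right blinfun.scaleR_right extend_def tproj_tangent)
  have ext: "covec p (ext_derivative (\<lambda>x. f x *\<^sub>R snd (u x)) p (fst (v p)))
      = covec p (\<lambda>w. D (fst (v p)) * blinfun_apply (snd (u p)) w
          - D w * blinfun_apply (snd (u p)) (fst (v p)))"
    using v(2) f(2) diff_S6_scaleR_zero[OF p f ap[OF d(2)]]
    by (intro covec_cong[OF p])
      (simp add: ext_derivative_def blinfun.scaleR_left extend_def tproj_tangent gen_tangent_def
        mem_Times_iff)
  have su: "covec p (blinfun_apply (snd (u p))) = snd (u p)"
    using u(2) by (simp add: covec_blinfun gen_tangent_def mem_Times_iff cotangent_def)
  have "lie_derivative (\<lambda>x. f x *\<^sub>R fst (u x)) (\<lambda>x. snd (v x)) p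
      - covec p (ext_derivative (\<lambda>x. f x *\<^sub>R snd (u x)) p (fst (v p)))
      = pairing (u p) (v p) *\<^sub>R covec p D - D (fst (v p)) *\<^sub>R covec p (blinfun_apply (snd (u p)))"
    unfolding lie ext pairing_def
    by (rule blinfun_eqI)
      (simp add: covec_apply lin blinfun.bounded_linear_right bounded_linear_mult_const
        bounded_linear_const_mult bounded_linear_sub blinfun.diff_left blinfun.add_left blinfun.scaleR_left algebra_simps)
  then show ?thesis
    using bracket[OF d(3)] unfolding su
    by (simp add: dorfman_def comp_def prod_eq_iff)
qed

lemma lie_bracket_cong:
  assumes "p \<in> S6" "\<And>x. x \<in> S6 \<Longrightarrow> X x = X' x" "\<And>x. x \<in> S6 \<Longrightarrow> Y x = Y' x"
  shows "lie_bracket X Y p = lie_bracket X' Y' p"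
  using assms diff_S6_cong[OF assms(1), of X X'] diff_S6_cong[OF assms(1), of Y Y']
  by (simp add: lie_bracket_def)

text \<open>Algebraic identities for \<J> hold only over the sphere, so rewriting inside a section
  relies on this congruence.\<close>

lemma dorfman_cong:
  assumes "p \<in> S6" "\<And>x. x \<in> S6 \<Longrightarrow> u x = u' x" "\<And>x. x \<in> S6 \<Longrightarrow> v x = v' x"
  shows "dorfman u v p = dorfman u' v' p"
proof -
  have "diff_S6 (\<lambda>x. blinfun_apply (snd (u x)) (extend w x)) p
      = diff_S6 (\<lambda>x. blinfun_apply (snd (u' x)) (extend w x)) p"
    "diff_S6 (\<lambda>x. blinfun_apply (snd (v x)) (extend w x)) p
      = diff_S6 (\<lambda>x. blinfun_apply (snd (v' x)) (extend w x)) p" for w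
    using assms by (auto intro!: diff_S6_cong)
  moreover have "lie_bracket (\<lambda>x. fst (u x)) Y p = lie_bracket (\<lambda>x. fst (u' x)) Y p"
    "lie_bracket (\<lambda>x. fst (u x)) (\<lambda>x. fst (v x)) p
      = lie_bracket (\<lambda>x. fst (u' x)) (\<lambda>x. fst (v' x)) p" for Y
    using assms by (auto intro!: lie_bracket_cong)
  ultimately show ?thesis
    using assms by (simp add: dorfman_def Let_def comp_def lie_derivative_def ext_derivative_def)
qed

lemma exists_orthogonal3:
  fixes x y z :: "real^7"
  obtains h where "h \<noteq> 0" "h \<bullet> x = 0" "h \<bullet> y = 0" "h \<bullet> z = 0"
proof -
  have "dim {x, y, z} \<le> card {x, y, z}" by (rule dim_le_card') simp
  also have "\<dots> < DIM(real^7)" by (simp add: card_insert_if)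
  finally obtain h where "h \<noteq> 0" "\<And>w. w \<in> span {x, y, z} \<Longrightarrow> orthogonal h w"
    using orthogonal_to_subspace_exists by blast
  then show ?thesis
    using that by (auto simp: orthogonal_def span_base)
qed

lemma weak_gen_complex_skew:
  assumes J: "weak_gen_complex \<J>" and p: "p \<in> S6"
    and u: "u \<in> gen_tangent p" and v: "v \<in> gen_tangent p"
  shows "pairing (\<J> p u) v + pairing u (\<J> p v) = 0"
proof -
  have B: "bundle_endomorphism \<J>" and sq: "\<And>u. u \<in> gen_tangent p \<Longrightarrow> \<J> p (\<J> p u) = - u"
    and int: "integrable_gen \<J>"
    using J p by (auto simp: weak_gen_complex_def weak_gen_almost_complex_def)
  have Jt: "\<And>x u. x \<in> S6 \<Longrightarrow> u \<in> gen_tangent x \<Longrightarrow> \<J> x u \<in> gen_tangent x"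
    and Js: "\<And>x r u. x \<in> S6 \<Longrightarrow> u \<in> gen_tangent x \<Longrightarrow> \<J> x (r *\<^sub>R u) = r *\<^sub>R \<J> x u"
    and Jsm: "\<And>s. s \<in> sections gen_tangent \<Longrightarrow> smooth_S6 (\<lambda>x. \<J> x (s x))"
    using B by (auto simp: bundle_endomorphism_def)
  \<comment> \<open>The function f(x) = h . x vanishes at \<open>p\<close>, and its differential
    there is nonzero because \<open>h\<close> is tangent. The other two conditions make df vanish on
    the vector parts of \<open>v\<close> and \<open>\<J> p v\<close>, so only the pairing term of
    the bracket survives.\<close>
  obtain h where h: "h \<noteq> 0" "h \<bullet> p = 0" "h \<bullet> fst v = 0" "h \<bullet> fst (\<J> p v) = 0"
    by (rule exists_orthogonal3)
  obtain s where s: "s \<in> sections gen_tangent" "(\<lambda>x. (h \<bullet> x) *\<^sub>R s x) \<in> sections gen_tangent" "s p = u"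
    using u bounded_linear_inner_right by (rule smooth_section_through)
  obtain t where t: "t \<in> sections gen_tangent" "t p = v"
    using v bounded_linear_zero by (rule smooth_section_through)
  define H where "H = covec p ((\<bullet>) h)"
  \<comment> \<open>The complex pairing of u - i\<J>u with v - i\<J>v is \<alpha> - i\<beta>; the
    goal is \<beta> = 0.\<close>
  define \<alpha> where "\<alpha> = pairing u v - pairing (\<J> p u) (\<J> p v)"
  define \<beta> where "\<beta> = pairing (\<J> p u) v + pairing u (\<J> p v)"
  define e where "e = (0 :: real^7, H)"
  have e: "e \<in> gen_tangent p"
    unfolding e_def H_def gen_tangent_def tangent_def
    using covec_in_cotangent[OF p bounded_linear_inner_right] by simp
  have "tproj p h = h" using h(2) by (simp add: tproj_def inner_commute)
  then have "blinfun_apply H h = h \<bullet> h"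
    by (simp add: H_def covec_apply bounded_linear_inner_right)
  then have e0: "e \<noteq> 0" using h(1) by (auto simp: e_def prod_eq_iff)
  have sd: "(\<lambda>x. s (sgn x)) differentiable (at p)" "(\<lambda>x. - \<J> (sgn x) (s (sgn x))) differentiable (at p)"
    "(\<lambda>x. t (sgn x)) differentiable (at p)" "(\<lambda>x. - \<J> (sgn x) (t (sgn x))) differentiable (at p)"
    using s(1) t(1) Jsm[OF s(1)] Jsm[OF t(1)] p
    by (auto simp: sections_def intro!: differentiable_minus smooth_S6_differentiable[of _ p]
        dest: smooth_S6_differentiable[of _ p])
  have neg: "- w \<in> gen_tangent p" if "w \<in> gen_tangent p" for w
    using gen_tangent_scaleR[OF that, of "-1"] by simp
  have hd: "((\<lambda>x. h \<bullet> sgn x) has_derivative (\<lambda>w. h \<bullet> tproj p w)) (at p)"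
    by (rule has_derivative_S6[OF p open_UNIV])
      (auto intro: bounded_linear_imp_has_derivative bounded_linear_inner_right)
  have H: "covec p (\<lambda>w. h \<bullet> tproj p w) = H"
    unfolding H_def by (intro covec_cong[OF p]) (simp add: tproj_tangent)
  have bracket: "dorfman (\<lambda>x. (h \<bullet> x) *\<^sub>R a x) b p = pairing (a p) (b p) *\<^sub>R e"
    if "(\<lambda>x. a (sgn x)) differentiable (at p)" "(\<lambda>x. b (sgn x)) differentiable (at p)"
      "a p \<in> gen_tangent p" "b p \<in> gen_tangent p" "h \<bullet> fst (b p) = 0" for a b
    using dorfman_scaleR_zero[OF p hd h(2) that(1,3,2,4)] that(4,5)
    by (simp add: H e_def tproj_tangent gen_tangent_def mem_Times_iff)
  have Jf: "dorfman (\<lambda>x. - \<J> x ((h \<bullet> x) *\<^sub>R s x)) b p = dorfman (\<lambda>x. (h \<bullet> x) *\<^sub>R (- \<J> x (s x))) b p" for b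
    using s(1) Js by (intro dorfman_cong[OF p]) (auto simp: sections_def)
  have "dorfman_C (\<lambda>x. holo_part (\<J> x) ((h \<bullet> x) *\<^sub>R s x)) (\<lambda>x. holo_part (\<J> x) (t x)) p
      = (\<alpha> *\<^sub>R e, - \<beta> *\<^sub>R e)"
    using bracket[OF sd(1,3)] bracket[OF sd(1,4)] bracket[OF sd(2,3)] bracket[OF sd(2,4)]
    by (simp add: s(3) t(2) h(3,4) u v Jt[OF p] neg dorfman_C_def holo_part_def comp_def Jf \<alpha>_def \<beta>_def
        pairing_minus scaleR_left.diff scaleR_left.add)
  moreover have "dorfman_C (\<lambda>x. holo_part (\<J> x) ((h \<bullet> x) *\<^sub>R s x)) (\<lambda>x. holo_part (\<J> x) (t x)) p \<in> L10 \<J> p"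
    using int s(2) t(1) p unfolding integrable_gen_def by (auto simp: sections_def)
  ultimately have "\<J> p (\<alpha> *\<^sub>R e) = \<beta> *\<^sub>R e"
    by (auto simp: L10_def holo_part_def)
  \<comment> \<open>No nonzero real \<open>e\<close> is an eigenvector of a map with square -1.
    Applying \<J> once more and multiplying by \<alpha> avoids dividing by \<alpha>, which may be
    zero.\<close>
  then have 1: "\<alpha> *\<^sub>R \<J> p e = \<beta> *\<^sub>R e" using Js[OF p e] by simp
  then have "\<J> p (\<alpha> *\<^sub>R \<J> p e) = \<J> p (\<beta> *\<^sub>R e)" by simp
  then have "- \<alpha> *\<^sub>R e = \<beta> *\<^sub>R \<J> p e" using Js p e Jt sq by simp
  then have "\<alpha> *\<^sub>R (- \<alpha> *\<^sub>R e) = \<beta> *\<^sub>R (\<alpha> *\<^sub>R \<J> p e)" by simp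
  then have "(\<alpha>\<^sup>2 + \<beta>\<^sup>2) *\<^sub>R e = 0"
    unfolding 1 by (simp add: power2_eq_square scaleR_left.add algebra_simps) (metis add.right_inverse)
  then show ?thesis
    using e0 by (simp add: \<beta>_def sum_power2_eq_zero_iff)
qed

section \<open>The fundamental form is not closed\<close>

text \<open>The derivative at \<open>p\<close> of the projected constant field \<open>v\<close> in
  direction \<open>w\<close> is -(w . v) p, which is symmetric in \<open>v\<close> and
  \<open>w\<close>.\<close>

lemma lie_bracket_extend:
  assumes p: "p \<in> S6" and "v \<in> tangent p" "w \<in> tangent p"
  shows "lie_bracket (extend v) (extend w) p = 0"
proof -
  have "diff_S6 (extend v) p w = - (w \<bullet> v) *\<^sub>R p" if "v \<in> tangent p" "w \<in> tangent p" for v w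
  proof -
    have "((\<lambda>x. tproj x v) has_derivative (\<lambda>h. - ((p \<bullet> v) *\<^sub>R h + (h \<bullet> v) *\<^sub>R p))) (at p)"
      unfolding tproj_def by (auto intro!: derivative_eq_intros)
    from diff_S6_eqI[OF has_derivative_S6[OF p open_UNIV UNIV_I refl this]] that show ?thesis
      by (simp add: extend_def tproj_tangent) (simp add: tangent_def)
  qed
  then show ?thesis
    using assms by (simp add: lie_bracket_def tproj_tangent extend_def inner_commute)
qed

text \<open>The coefficients \<open>S\<close> and \<open>T\<close> are linear in the base point, so
  differentiating them along a tangent vector just inserts that vector; the brackets of the extended
  fields vanish at \<open>p\<close>.\<close>

lemma dorfman_extend:
  assumes p: "p \<in> S6" and v: "v \<in> tangent p" "v' \<in> tangent p"
    and S: "\<And>x w. x \<in> S6 \<Longrightarrow> blinfun_apply (\<xi> x) (extend w x) = S x w"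
      "\<And>w. bounded_linear (\<lambda>x. S x w)" "\<And>x. bounded_linear (S x)"
    and T: "\<And>x w. x \<in> S6 \<Longrightarrow> blinfun_apply (\<eta> x) (extend w x) = T x w"
      "\<And>w. bounded_linear (\<lambda>x. T x w)" "\<And>x. bounded_linear (T x)"
  shows "dorfman (\<lambda>x. (extend v x, \<xi> x)) (\<lambda>x. (extend v' x, \<eta> x)) p
    = (0, covec p (\<lambda>w. T v w - (S v' w - S w v')))"
proof -
  have ext: "extend v p = v" "extend v' p = v'"
    using v by (simp_all add: extend_def tproj_tangent)
  have d: "diff_S6 (\<lambda>x. blinfun_apply (\<xi> x) (extend w x)) p y = S (tproj p y) w"
    "diff_S6 (\<lambda>x. blinfun_apply (\<eta> x) (extend w x)) p y = T (tproj p y) w" for w y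
    by (rule diff_S6_bounded_linear[OF p S(2) S(1)] diff_S6_bounded_linear[OF p T(2) T(1)]; assumption)+
  have "lie_derivative (extend v) \<eta> p = covec p (T v)"
    unfolding lie_derivative_def using v
    by (intro covec_cong[OF p]) (simp add: lie_bracket_extend[OF p] d tproj_tangent ext(1))
  moreover have "covec p (ext_derivative \<xi> p v') = covec p (\<lambda>w. S v' w - S w v')"
    using v
    by (intro covec_cong[OF p]) (simp add: ext_derivative_def lie_bracket_extend[OF p] tproj_tangent d)
  ultimately show ?thesis
    using v lie_bracket_extend[OF p]
    by (simp add: dorfman_def comp_def covec_diff T(3) S(2,3) bounded_linear_sub ext)
qed

section \<open>Algebra of the seven-dimensional cross product\<close>

lemma cross7_self: "cross7 x x = 0"
  by (simp add: cross7_def fano_def)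

lemma inner_cross7_left: "cross7 x y \<bullet> x = 0"
  by (simp add: cross7_def fano_def inner_add_left inner_axis' algebra_simps)

text \<open>These two transpositions generate all permutations, so (x, y, z) \<mapsto> (x cross y) .
  z is a 3-form.\<close>

lemma cross7_skew:
  "cross7 x y \<bullet> z = - (cross7 x z \<bullet> y)"
  "cross7 x y \<bullet> z = - (cross7 y x \<bullet> z)"
  by (simp_all add: cross7_def fano_def inner_add_left inner_axis' algebra_simps)

lemma bounded_linear_cross7: "bounded_linear (\<lambda>x. cross7 x y)" "bounded_linear (cross7 x)"
  unfolding linear_conv_bounded_linear[symmetric]
  by (rule linearI; simp add: cross7_def fano_def algebra_simps)+

lemma cross7_0: "cross7 0 x = 0" "cross7 x 0 = 0"
  by (simp_all add: cross7_def fano_def)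

lemma cross7_tproj: "cross7 x (tproj x v) = cross7 x v"
  by (simp add: tproj_def cross7_self linear_diff linear_scale
      bounded_linear.linear[OF bounded_linear_cross7(2)])

lemma UNIV_7: "(UNIV :: 7 set) = {1, 2, 3, 4, 5, 6, 7}"
  by (rule sym, rule card_subset_eq) simp_all

lemma cross7_nondegenerate:
  assumes "\<And>w. cross7 p w = 0"
  shows "p = 0"
proof -
  \<comment> \<open>Multiplying by e_1 exposes, up to sign, every coordinate of \<open>p\<close> but
    the first, which is the third coordinate of p cross e_2.\<close>
  have "cross7 p (axis 1 1) $ i = 0" "cross7 p (axis 2 1) $ 3 = 0" for i
    using assms by simp_all
  from this(1)[of 2] this(1)[of 3] this(1)[of 4] this(1)[of 5] this(1)[of 6] this(1)[of 7] this(2)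
  have "\<forall>i\<in>{1, 2, 3, 4, 5, 6, 7}. p $ i = 0"
    by (simp add: cross7_def fano_def axis_def)
  then show ?thesis
    by (simp add: vec_eq_iff flip: UNIV_7)
qed

text \<open>All projections are absorbed because x cross v is orthogonal to x and x cross x = 0.
  What remains is linear in x, as \<open>dorfman_extend\<close> demands.\<close>

lemma flat_fund_form_extend:
  assumes "x \<in> S6"
  shows "blinfun_apply (flat fund_form x (extend v x)) (extend w x) = cross7 x v \<bullet> w"
proof -
  have "cross7 x v \<bullet> tproj x w = cross7 x v \<bullet> w"
    by (simp add: tproj_def inner_diff_right inner_cross7_left)
  moreover have "blinfun_apply (flat fund_form x (extend v x)) (extend w x)
      = cross7 x v \<bullet> tproj x (tproj x w)"
    unfolding flat_def fund_form_def round_metric_def acs_def extend_def cross7_tproj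
    by (rule covec_apply) (rule bounded_linear_inner_right)
  ultimately show ?thesis
    using assms by (simp add: tproj_idem)
qed

text \<open>Values on pure vector fields suffice: for extended fields v, v' the imaginary part of
  the bracket at \<open>p\<close> is the covector -k d\<omega>(v, v', .).\<close>

lemma fund_form_not_integrable:
  assumes J: "weak_gen_complex \<J>"
    and eq: "\<And>x v. x \<in> S6 \<Longrightarrow> v \<in> tangent x \<Longrightarrow> \<J> x (v, 0) = (0, k *\<^sub>R flat fund_form x v)"
  shows "k = 0"
proof -
  \<comment> \<open>(2,4,6) is a line of \<open>fano\<close> avoiding 1, so e_2 cross e_4 = e_6 and
    all three vectors are tangent at e_1.\<close>
  define p v v' w :: "real^7" where "p = axis 1 1" and "v = axis 2 1" and "v' = axis 4 1" and "w = axis 6 1"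
  have p: "p \<in> S6" by (simp add: p_def)
  have tan: "v \<in> tangent p" "v' \<in> tangent p" "w \<in> tangent p"
    by (simp_all add: p_def v_def v'_def w_def tangent_def inner_axis_axis)
  have vol: "cross7 v v' \<bullet> w = 1"
  proof -
    have "cross7 v v' = w"
      by (simp add: cross7_def fano_def v_def v'_def w_def) (simp add: axis_def)
    then show ?thesis by (simp add: w_def inner_axis_axis)
  qed
  let ?s = "\<lambda>y x. (extend y x, 0 :: covector)"
  \<comment> \<open>The zero vector part is written \<open>extend 0 x\<close> to fit the shape of
    \<open>dorfman_extend\<close>.\<close>
  let ?N = "\<lambda>y x. (extend 0 x, - (k *\<^sub>R flat fund_form x (extend y x)))"
  have sec: "?s y \<in> sections gen_tangent" for y
  proof -
    have "covec x (blinfun_apply 0) = 0" for x by (simp add: covec_blinfun)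
    then show ?thesis
      using smooth_S6_of_UNIV[OF smooth_on_tproj_covec[of y 0]] tproj_covec_in_gen_tangent[of _ y 0]
      by (simp add: sections_def extend_def)
  qed
  have N: "- \<J> x (?s y x) = ?N y x" if "x \<in> S6" for x y
    using that by (simp add: eq extend_def tproj_in_tangent) (simp add: tproj_def)
  have bl: "bounded_linear (\<lambda>x. - (k * (cross7 x y \<bullet> z)))" "bounded_linear (\<lambda>z. - (k * (cross7 x y \<bullet> z)))"
    for x y z
    by (intro bounded_linear_minus bounded_linear_const_mult bounded_linear_inner_left
        bounded_linear_inner_right bounded_linear_compose[OF bounded_linear_inner_left bounded_linear_cross7(1)])+
  have ap: "blinfun_apply (- (k *\<^sub>R flat fund_form x (extend y x))) (extend z x) = - (k * (cross7 x y \<bullet> z))"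
    if "x \<in> S6" for x y z
    using that by (simp add: blinfun.minus_left blinfun.scaleR_left flat_fund_form_extend)
  have z: "0 \<in> tangent p" by (simp add: tangent_def)
  have zero: "bounded_linear (\<lambda>_. 0 :: real)" by (rule bounded_linear_zero)
  have AC: "dorfman (?s v) (?s v') p = 0"
    using dorfman_extend[OF p tan(1,2), of "\<lambda>_. 0" "\<lambda>_ _. 0" "\<lambda>_. 0" "\<lambda>_ _. 0"]
    by (simp add: covec_0 zero_prod_def)
  have BD: "dorfman (\<lambda>x. - \<J> x (?s v x)) (\<lambda>x. - \<J> x (?s v' x)) p = 0"
    using dorfman_extend[OF p z z ap bl(1) bl(2) ap bl(1) bl(2), of v v']
    by (subst dorfman_cong[OF p N N]) (simp_all add: cross7_0 covec_0 zero_prod_def)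
  have AD: "dorfman (?s v) (\<lambda>x. - \<J> x (?s v' x)) p = (0, covec p (\<lambda>w. - (k * (cross7 v v' \<bullet> w))))"
    using dorfman_extend[OF p tan(1) z _ zero zero ap bl(1) bl(2), of "\<lambda>_. 0" v']
    by (subst dorfman_cong[OF p refl N]) simp_all
  have BC: "dorfman (\<lambda>x. - \<J> x (?s v x)) (?s v') p
      = (0, covec p (\<lambda>w. k * (cross7 v' v \<bullet> w) - k * (cross7 w v \<bullet> v')))"
    using dorfman_extend[OF p z tan(2) ap bl(1) bl(2) _ zero zero, of "\<lambda>_. 0" v]
    by (subst dorfman_cong[OF p N refl]) simp_all
  have "dorfman_C (\<lambda>x. holo_part (\<J> x) (?s v x)) (\<lambda>x. holo_part (\<J> x) (?s v' x)) p \<in> L10 \<J> p"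
    using J sec p by (auto simp: weak_gen_complex_def integrable_gen_def sections_def)
  \<comment> \<open>The real part of the bracket is zero by \<open>AC\<close> and \<open>BD\<close>,
    so membership in \<open>L10\<close> forces the imaginary part to be
    \<open>- \<J> p 0\<close>.\<close>
  then have "dorfman (?s v) (\<lambda>x. - \<J> x (?s v' x)) p + dorfman (\<lambda>x. - \<J> x (?s v x)) (?s v') p = - \<J> p 0"
    by (auto simp: dorfman_C_def holo_part_def comp_def L10_def AC BD)
  also have "\<J> p 0 = 0"
    using eq[OF p z] by (simp add: flat_def fund_form_def round_metric_def acs_def cross7_0
        covec_0 zero_prod_def)
  finally have "blinfun_apply (covec p (\<lambda>w. - (k * (cross7 v v' \<bullet> w)))) w
      + blinfun_apply (covec p (\<lambda>w. k * (cross7 v' v \<bullet> w) - k * (cross7 w v \<bullet> v'))) w = 0"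
    by (simp add: AD BC zero_prod_def blinfun.add_left[symmetric])
  moreover have "bounded_linear (\<lambda>w. k * (cross7 v' v \<bullet> w) - k * (cross7 w v \<bullet> v'))"
    by (intro bounded_linear_sub bounded_linear_const_mult bounded_linear_inner_right
        bounded_linear_compose[OF bounded_linear_inner_left bounded_linear_cross7(1)])
  ultimately have "- k * (cross7 v v' \<bullet> w) + (k * (cross7 v' v \<bullet> w) - k * (cross7 w v \<bullet> v')) = 0"
    using tan(3) bl(2) by (simp add: covec_apply tproj_tangent)
  \<comment> \<open>By skew-symmetry each of the three terms above equals -k, so their sum is
    -3k.\<close>
  moreover have "cross7 v' v \<bullet> w = - 1" "cross7 w v \<bullet> v' = 1"
    using vol cross7_skew(2)[of v' v w] cross7_skew(2)[of w v v'] cross7_skew(1)[of v w v'] by simp_all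
  ultimately show ?thesis
    by (simp add: vol)
qed

section \<open>Conclusion: vanishing of a and b, constancy of c\<close>

theorem theorem1p1:
  shows "\<not> (\<exists>a b c :: real^7 \<Rightarrow> real.
            smooth_S6 a \<and> smooth_S6 b \<and> smooth_S6 c \<and>
            (\<forall>p\<in>S6. (a p)\<^sup>2 + (b p)\<^sup>2 + (c p)\<^sup>2 = 1) \<and>
            weak_gen_complex
              (\<lambda>p u. a p *\<^sub>R J_one p u + b p *\<^sub>R J_bilin round_metric p u + c p *\<^sub>R J_bilin fund_form p u))"
proof (intro notI, elim exE conjE)
  fix a b c :: "real^7 \<Rightarrow> real"
  assume c: "smooth_S6 c" and one: "\<forall>p\<in>S6. (a p)\<^sup>2 + (b p)\<^sup>2 + (c p)\<^sup>2 = 1"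
    and J: "weak_gen_complex
      (\<lambda>p u. a p *\<^sub>R J_one p u + b p *\<^sub>R J_bilin round_metric p u + c p *\<^sub>R J_bilin fund_form p u)"
      (is "weak_gen_complex ?J")
  have flat0: "flat round_metric p 0 = 0" "flat fund_form p 0 = 0" for p
    by (simp_all add: flat_def fund_form_def round_metric_def acs_def cross7_0 covec_0)
  \<comment> \<open>\<open>sharp\<close> is a chosen inverse. Linearity of the whole endomorphism
    shows that its values at 0 contribute nothing in total, without inverting
    \<open>flat\<close>.\<close>
  have J0: "?J p 0 = 0" if "p \<in> S6" for p
  proof -
    have "0 \<in> gen_tangent p"
      by (simp add: gen_tangent_def tangent_def cotangent_def zero_prod_def)
    then have "?J p (0 *\<^sub>R 0) = 0 *\<^sub>R ?J p 0"
      using J that unfolding weak_gen_complex_def weak_gen_almost_complex_def bundle_endomorphism_def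
      by meson
    then show ?thesis by simp
  qed
  have JX: "?J p (X, 0) = (a p *\<^sub>R cross7 p X, b p *\<^sub>R flat round_metric p X + c p *\<^sub>R flat fund_form p X)"
    if "p \<in> S6" for p X
    using J0[OF that] by (simp add: J_one_def J_bilin_def zero_prod_def flat0 acs_def cross7_0)
  \<comment> \<open>Pairing with (X, 0) sees only the covector part, so the values of
    \<open>sharp\<close> at \<xi> never enter.\<close>
  have J\<xi>: "snd (J_one p (0, \<xi>)) = covec p (\<lambda>Y. blinfun_apply \<xi> (cross7 p Y))"
    "snd (J_bilin round_metric p (0, \<xi>)) = 0" "snd (J_bilin fund_form p (0, \<xi>)) = 0" for p \<xi>
    by (simp_all add: J_one_def J_bilin_def flat0 acs_def)
  have ab: "a p = 0 \<and> b p = 0" if p: "p \<in> S6" for p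
  proof -
    have "p \<noteq> 0" using p by auto
    then obtain w where "cross7 p w \<noteq> 0" using cross7_nondegenerate by blast
    then obtain X where X: "X \<in> tangent p" "cross7 p X \<noteq> 0"
      using cross7_tproj tproj_in_tangent[OF p] by metis
    \<comment> \<open>With this \<xi>, skewness on (X, 0) and (0, \<xi>) reads 2a |p cross X|^2 = 0,
      while on (X, 0) taken twice it reads 2b |X|^2 = 0, the \<omega> term vanishing by
      skew-symmetry.\<close>
    define \<xi> where "\<xi> = blinfun_inner_right (cross7 p X)"
    have mem: "(X, 0) \<in> gen_tangent p" "(0, \<xi>) \<in> gen_tangent p"
      using X by (auto simp: gen_tangent_def tangent_def cotangent_def \<xi>_def inner_cross7_left)
    have "cross7 p X \<bullet> X = 0"
      using cross7_skew(1)[of p X X] by simp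
    then have "2 * b p * (X \<bullet> X) = 0"
      using weak_gen_complex_skew[OF J p mem(1) mem(1)] X(1)
      by (simp add: pairing_def JX[OF p] blinfun.add_left blinfun.scaleR_left flat_def
          fund_form_def round_metric_def acs_def covec_apply bounded_linear_inner_right tproj_tangent)
    moreover have "X \<noteq> 0" using X(2) by (auto simp: cross7_0)
    moreover have "2 * a p * (cross7 p X \<bullet> cross7 p X) = 0"
      using weak_gen_complex_skew[OF J p mem] X(1)
      by (simp add: pairing_def JX[OF p] J\<xi> blinfun.scaleR_left covec_apply tproj_tangent \<xi>_def
          bounded_linear_compose[OF bounded_linear_inner_right bounded_linear_cross7(2)])
    ultimately show ?thesis using X(2) by simp
  qed
  have "c p = 1 \<or> c p = -1" if "p \<in> S6" for p
    using one ab that by (simp add: power2_eq_1_iff)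
  \<comment> \<open>A continuous function with finite range on the connected sphere is
    constant.\<close>
  then have "c ` S6 \<subseteq> {1, -1}" by blast
  then have "finite (c ` S6)" by (rule finite_subset) simp
  then have "c constant_on S6"
    using smooth_S6_continuous_on[OF c]
    by (intro continuous_finite_range_constant connected_sphere) simp_all
  then obtain k where k: "\<And>x. x \<in> S6 \<Longrightarrow> c x = k"
    by (auto simp: constant_on_def)
  have "k = 0"
    by (rule fund_form_not_integrable[OF J], unfold JX) (simp_all add: ab k)
  moreover have "axis 1 1 \<in> S6" by simp
  ultimately show False
    using one ab k by fastforce
qed

end
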